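(* For each natural number $n$, there exists a unique integer $k$ such that $T(p+n)\equiv k \pmod p$ for all primes $p$.
   Context: For a natural number $m$, $T(m)$ denotes the number of distinct topologies which can be defined on a set with $m$ elements (topologies are counted as distinct families of subsets, not up to homeomorphism). Natural numbers include $0$. The integer $k$ depends on $n$ only, not on the prime $p$. *)

theory Defs
  imports "HOL-Analysis.Abstract_Topology" "HOL-Number_Theory.Cong"
    "HOL-Computational_Algebra.Primes"
begin

(* An element of nat topology is determined by its family of open sets
   (topology_eq), so homeomorphic but different families are counted separately.
   The lemmas below show that the choice of the underlying set is irrelevant
   and that card is applied to a finite set. *)
definition num_topologies :: "nat \<Rightarrow> nat" where
  "num_topologies m = card {X :: nat topology. topspace X = {..<m}}"

lemma finite_topologies_on:
  assumes "finite S"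
  shows "finite {X :: 'a topology. topspace X = S}"
proof (rule inj_on_finite)
  show "inj_on (\<lambda>X. Collect (openin X)) {X :: 'a topology. topspace X = S}"
    by (auto simp: inj_on_def topology_eq set_eq_iff)
  show "(\<lambda>X. Collect (openin X)) ` {X :: 'a topology. topspace X = S} \<subseteq> Pow (Pow S)"
    using openin_subset by fastforce
  show "finite (Pow (Pow S))"
    using assms by simp
qed

lemma card_topologies_on_le:
  assumes "finite S" "finite S'" "card S = card S'"
  shows "card {X :: 'a topology. topspace X = S} \<le> card {X :: 'b topology. topspace X = S'}"
proof -
  obtain f where f: "bij_betw f S' S"
    using assms finite_same_card_bij by metis
  let ?A = "{X :: 'a topology. topspace X = S}"
  let ?B = "{X :: 'b topology. topspace X = S'}"
  let ?h = "\<lambda>X. pullback_topology S' f X"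
  have "inj_on ?h ?A"
  proof (rule inj_onI)
    fix X Y :: "'a topology"
    assume X: "X \<in> ?A" and Y: "Y \<in> ?A" and eq: "?h X = ?h Y"
    have sub: "openin W U"
      if "openin Z U" "?h Z = ?h W" "topspace Z = S" "topspace W = S" for Z W :: "'a topology" and U
    proof -
      have "openin (?h Z) (f -` U \<inter> S')"
        using that(1) by (auto simp: openin_pullback_topology)
      then have "openin (?h W) (f -` U \<inter> S')"
        using that(2) by simp
      then obtain V where V: "openin W V" "f -` U \<inter> S' = f -` V \<inter> S'"
        by (auto simp: openin_pullback_topology)
      have US: "U \<subseteq> S" "V \<subseteq> S"
        using that V openin_subset by blast+
      have "U = f ` (f -` U \<inter> S')" "V = f ` (f -` V \<inter> S')"
        using US f by (auto simp: bij_betw_def)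
      then show ?thesis using V by simp
    qed
    show "X = Y"
      using X Y eq sub[of X _ Y] sub[of Y _ X] by (auto simp: topology_eq)
  qed
  moreover have "?h ` ?A \<subseteq> ?B"
    using f by (auto simp: topspace_pullback_topology bij_betw_def)
  ultimately show ?thesis
    using card_inj_on_le finite_topologies_on[OF assms(2)] by blast
qed

lemma card_topologies_on:
  assumes "finite S"
  shows "card {X :: 'a topology. topspace X = S} = num_topologies (card S)"
  unfolding num_topologies_def
  by (rule antisym; rule card_topologies_on_le) (use assms in auto)

end

theory Submission
  imports Defs
begin

text \<open>
  Uniqueness of \<open>k\<close>: two candidates are congruent modulo every prime, hence equal
  (\<open>cong_all_primes_imp_eq\<close>).

  Existence: a topology on a finite set is the same thing as a preorder on that set, whose open
  sets are the up-closed ones (\<open>num_topologies_eq_card_preorders\<close>). Leave the first \<open>n\<close> of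
  the \<open>p + n\<close> points in place and rotate the remaining \<open>p\<close> points, the block
  \<open>{n..<p + n}\<close>, cyclically. The cyclic group of order \<open>p\<close> then acts on the preorders, and
  since every orbit has size \<open>1\<close> or \<open>p\<close>, the number of all preorders is congruent modulo \<open>p\<close>
  to the number of invariant ones (\<open>cong_card_fixed_points\<close>).

  An invariant preorder has little freedom. If two different points of the block are comparable,
  repeating that step through the block reaches every point from every other one, because \<open>p\<close> is
  prime; so the block is either an antichain or a single equivalence class
  (\<open>invariant_preorder_indiscrete\<close>). A fixed point relates to all points of the block in the same
  way (\<open>invariant_preorder_block_uniform\<close>). Hence the preorder is described by the preorder
  obtained by collapsing the block to one point, the point \<open>n\<close> of \<open>{..n}\<close>, together with one
  bit telling whether the block is indiscrete. All such pairs occur, except that an antichain is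
  impossible when \<open>n\<close> is equivalent to a fixed point \<open>a\<close>: then \<open>x \<le> a \<le> y\<close> for all \<open>x\<close>, \<open>y\<close>
  in the block. The admissible pairs, the elements of \<open>patterns n\<close>, do not mention \<open>p\<close>, and
  \<open>k\<close> is their number.
\<close>

section \<open>Finite topologies as preorders\<close>

text \<open>The specialization preorder, oriented so that the open sets are closed upwards.\<close>

definition spec_preorder :: "'a topology \<Rightarrow> 'a rel" where
  "spec_preorder X = {(x, y) \<in> topspace X \<times> topspace X. \<forall>U. openin X U \<longrightarrow> x \<in> U \<longrightarrow> y \<in> U}"

definition upset_topology :: "'a set \<Rightarrow> 'a rel \<Rightarrow> 'a topology" where
  "upset_topology S r = topology (\<lambda>U. U \<subseteq> S \<and> r `` U \<subseteq> U)"

lemma openin_upset_topology: "openin (upset_topology S r) U \<longleftrightarrow> U \<subseteq> S \<and> r `` U \<subseteq> U"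
proof -
  have "istopology (\<lambda>U. U \<subseteq> S \<and> r `` U \<subseteq> U)"
    unfolding istopology_def by blast
  then show ?thesis
    by (simp add: upset_topology_def topology_inverse')
qed

lemma topspace_upset_topology: "r \<subseteq> S \<times> S \<Longrightarrow> topspace (upset_topology S r) = S"
  unfolding topspace_def openin_upset_topology by blast

lemma preorder_on_spec_preorder: "preorder_on (topspace X) (spec_preorder X)"
  by (auto simp: spec_preorder_def preorder_on_def refl_on_def intro!: transI)

lemma spec_preorder_upset_topology:
  assumes "preorder_on S r"
  shows "spec_preorder (upset_topology S r) = r"
proof -
  have r: "r \<subseteq> S \<times> S" "\<And>x. x \<in> S \<Longrightarrow> (x, x) \<in> r" "trans r"
    using assms by (auto simp: preorder_on_def refl_on_def)
  have "(x, y) \<in> r"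
    if "x \<in> S" "\<forall>U. U \<subseteq> S \<and> r `` U \<subseteq> U \<longrightarrow> x \<in> U \<longrightarrow> y \<in> U" for x y
  proof -
    have "r `` {x} \<subseteq> S \<and> r `` (r `` {x}) \<subseteq> r `` {x}"
      using r(1,3) by (auto dest: transD)
    then show ?thesis using that r(2) by blast
  qed
  then show ?thesis
    using r(1) unfolding spec_preorder_def topspace_upset_topology[OF r(1)] openin_upset_topology
    by blast
qed

text \<open>Finiteness enters here: the intersection of all open neighbourhoods of a point is itself
  open, and it is the set of points above that point. An up-closed set is the union of these
  minimal neighbourhoods.\<close>

lemma upset_topology_spec_preorder:
  assumes "finite (topspace X)"
  shows "upset_topology (topspace X) (spec_preorder X) = X"
  unfolding topology_eq openin_upset_topology
proof (intro allI iffI conjI)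
  fix U assume U: "U \<subseteq> topspace X \<and> spec_preorder X `` U \<subseteq> U"
  have "\<exists>V. openin X V \<and> x \<in> V \<and> V \<subseteq> U" if "x \<in> U" for x
  proof (intro exI conjI)
    let ?N = "{V. openin X V \<and> x \<in> V}"
    have "?N \<subseteq> Pow (topspace X)"
      using openin_subset by blast
    then have "finite ?N"
      using assms finite_subset by blast
    moreover have "topspace X \<in> ?N"
      using that U by auto
    ultimately show "openin X (\<Inter>?N)"
      by (intro openin_Inter) auto
    show "x \<in> \<Inter>?N" by simp
    show "\<Inter>?N \<subseteq> U"
    proof
      fix y assume y: "y \<in> \<Inter>?N"
      have "(x, y) \<in> spec_preorder X"
        using y that U \<open>topspace X \<in> ?N\<close> unfolding spec_preorder_def by blast
      then show "y \<in> U" using U that by blast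
    qed
  qed
  then show "openin X U"
    by (subst openin_subopen) blast
qed (auto simp: spec_preorder_def dest: openin_subset)

lemma num_topologies_eq_card_preorders:
  fixes S :: "'a set"
  assumes "finite S"
  shows "num_topologies (card S) = card {r. preorder_on S r}"
proof -
  have "bij_betw spec_preorder {X. topspace X = S} {r. preorder_on S r}"
  proof (rule bij_betw_byWitness[where f' = "upset_topology S"])
    show "upset_topology S ` {r. preorder_on S r} \<subseteq> {X. topspace X = S}"
      using topspace_upset_topology by (auto simp: preorder_on_def)
  qed (use assms in \<open>auto simp: upset_topology_spec_preorder spec_preorder_upset_topology
         preorder_on_spec_preorder\<close>)
  then show ?thesis
    using card_topologies_on[OF assms] bij_betw_same_card by metis
qed

section \<open>Counting fixed points modulo a prime\<close>

text \<open>The points that \<open>f\<close> moves split into orbits of exactly \<open>p\<close> elements: an element fixed by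
  \<open>f ^^ i\<close> and by \<open>f ^^ p\<close> with \<open>i\<close> prime to \<open>p\<close> is fixed by \<open>f\<close> (Bezout).\<close>

lemma cong_card_fixed_points:
  fixes f :: "'a \<Rightarrow> 'a"
  assumes "prime p" "finite X" and fX: "f ` X \<subseteq> X"
    and per: "\<And>x. x \<in> X \<Longrightarrow> (f ^^ p) x = x"
  shows "[card X = card {x \<in> X. f x = x}] (mod p)"
proof -
  have p: "p > 0" using assms(1) prime_gt_0_nat by blast
  let ?M = "{x \<in> X. f x \<noteq> x}"
  let ?orb = "\<lambda>x. (\<lambda>i. (f ^^ i) x) ` {..<p}"
  have stay: "(f ^^ i) x \<in> X" if "x \<in> X" for i x
    using that fX by (induction i) auto
  have perm: "(f ^^ (p * k)) x = x" if "x \<in> X" for k x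
    using per[OF that] that by (induction k) (auto simp: funpow_add)
  (* f is invertible on X; natural subtraction is harmless since i <= p * i. *)
  have undo: "(f ^^ (p * i - i)) ((f ^^ i) x) = x" if "x \<in> X" for i x
    using perm[OF that, of i] p by (simp add: funpow_add[symmetric, THEN fun_cong, unfolded o_def])
  have fixd: "f x = x" if x: "x \<in> X" and i: "(f ^^ i) x = x" "\<not> p dvd i" for i x
  proof -
    have "coprime i p"
      using i(2) \<open>prime p\<close> prime_imp_coprime coprime_commute by blast
    moreover have "i \<noteq> 0" using i(2) by (metis dvd_0_right)
    ultimately obtain a b where ab: "i * a = p * b + 1"
      using bezout_nat[of i p] by auto
    have "(f ^^ (i * a)) x = x"
      using i(1) by (induction a) (auto simp: funpow_add)
    moreover have "(f ^^ (p * b + 1)) x = f ((f ^^ (p * b)) x)"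
      by simp
    ultimately show ?thesis
      using ab perm[OF x] by metis
  qed
  have moved: "(f ^^ i) x \<in> ?M" if "x \<in> ?M" for i x
  proof -
    have x: "x \<in> X" using that by auto
    have "f ((f ^^ i) x) \<noteq> (f ^^ i) x"
    proof
      assume "f ((f ^^ i) x) = (f ^^ i) x"
      then have "(f ^^ i) (f x) = (f ^^ i) x"
        by (simp add: funpow_swap1)
      then have "(f ^^ (p * i - i)) ((f ^^ i) (f x)) = (f ^^ (p * i - i)) ((f ^^ i) x)"
        by simp
      then show False
        using undo[OF x] undo[of "f x"] fX x that by auto
    qed
    then show ?thesis using stay x by auto
  qed
  have orb_inj: "inj_on (\<lambda>i. (f ^^ i) x) {..<p}" if "x \<in> ?M" for x
  proof (rule linorder_inj_onI)
    fix i j assume ij: "i < j" "i \<in> {..<p}" "j \<in> {..<p}"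
    have "\<not> p dvd (j - i)"
      using ij by (auto dest: dvd_imp_le)
    moreover have "(f ^^ (j - i)) ((f ^^ i) x) = (f ^^ j) x"
      using ij by (simp add: funpow_add[symmetric, THEN fun_cong, unfolded o_def])
    ultimately show "(f ^^ i) x \<noteq> (f ^^ j) x"
      using fixd[of "(f ^^ i) x" "j - i"] moved[OF that, of i] by auto
  qed auto
  have orb_eq: "?orb x = ?orb y" if xy: "x \<in> X" "y \<in> X" "?orb x \<inter> ?orb y \<noteq> {}" for x y
  proof -
    have all: "?orb z = range (\<lambda>i. (f ^^ i) z)" if "z \<in> X" for z
    proof -
      have "(f ^^ i) z = (f ^^ (i mod p)) z" for i
        using funpow_mod_eq[OF per[OF that], of i] by simp
      moreover have "i mod p \<in> {..<p}" for i using p by simp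
      ultimately show ?thesis
        by (metis (no_types, lifting) image_subset_iff rangeI image_eqI subset_antisym)
    qed
    have sub: "range (\<lambda>i. (f ^^ i) z) \<subseteq> range (\<lambda>i. (f ^^ i) w)"
      if "z \<in> X" "(f ^^ i) z = (f ^^ j) w" for z w i j
    proof -
      have z: "z = (f ^^ (p * i - i + j)) w"
        using undo[OF that(1), of i] that(2) by (simp add: funpow_add)
      show ?thesis
        by (subst z) (auto simp: funpow_add[symmetric, THEN fun_cong, unfolded o_def])
    qed
    obtain i j where "(f ^^ i) x = (f ^^ j) y"
      using xy(3) by auto
    then show ?thesis
      unfolding all[OF xy(1)] all[OF xy(2)] using sub xy by (metis subset_antisym)
  qed
  have un: "\<Union>(?orb ` ?M) = ?M"
  proof
    show "\<Union>(?orb ` ?M) \<subseteq> ?M" using moved by blast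
    have "x \<in> ?orb x" for x
      using p by (auto intro!: image_eqI[of _ _ 0])
    then show "?M \<subseteq> \<Union>(?orb ` ?M)" by blast
  qed
  have "p dvd card (\<Union>(?orb ` ?M))"
  proof (rule dvd_partition)
    show "finite (\<Union>(?orb ` ?M))" unfolding un using assms by simp
    show "\<forall>c\<in>?orb ` ?M. p dvd card c"
      using orb_inj by (auto simp: card_image)
    show "\<forall>c1\<in>?orb ` ?M. \<forall>c2\<in>?orb ` ?M. c1 \<noteq> c2 \<longrightarrow> c1 \<inter> c2 = {}"
      using orb_eq by blast
  qed
  then have "p dvd card ?M" unfolding un .
  moreover have "card X = card {x \<in> X. f x = x} + card ?M"
    using \<open>finite X\<close> by (subst card_Un_disjoint[symmetric]) (auto intro: arg_cong[where f = card])
  ultimately show ?thesis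
    by (simp add: cong_def mod_add_eq[symmetric] dvd_eq_mod_eq_0)
qed

section \<open>Rotation-invariant preorders\<close>

text \<open>The map \<open>rot n p i\<close> fixes \<open>{..<n}\<close> and shifts the block \<open>{n..<p + n}\<close> cyclically
  by \<open>i\<close>. Putting the block last makes both the fixed points and the collapsed point \<open>n\<close>
  independent of \<open>p\<close>.\<close>

definition rot :: "nat \<Rightarrow> nat \<Rightarrow> nat \<Rightarrow> nat \<Rightarrow> nat" where
  "rot n p i x = (if x < n then x else n + (x - n + i) mod p)"

definition rotrel :: "nat \<Rightarrow> nat \<Rightarrow> nat \<Rightarrow> nat rel \<Rightarrow> nat rel" where
  "rotrel n p i r = map_prod (rot n p i) (rot n p i) ` r"

lemma rot_rot: "rot n p i (rot n p j x) = rot n p (i + j) x"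
  by (auto simp: rot_def mod_add_left_eq mod_add_right_eq ac_simps)

lemma rot_period: "x < p + n \<Longrightarrow> rot n p (p * k) x = x"
  by (auto simp: rot_def not_less le_iff_add)

lemma rot_less: "p > 0 \<Longrightarrow> x < p + n \<Longrightarrow> rot n p i x < p + n"
  by (auto simp: rot_def)

lemma rot_less_iff: "rot n p i x < n \<longleftrightarrow> x < n"
  by (auto simp: rot_def)

lemma rotrel_rotrel: "rotrel n p i (rotrel n p j r) = rotrel n p (i + j) r"
  by (auto simp: rotrel_def rot_rot image_image map_prod_def split_beta)

lemma rotrel_period:
  assumes "r \<subseteq> {..<p + n} \<times> {..<p + n}"
  shows "rotrel n p (p * k) r = r"
proof -
  have "map_prod (rot n p (p * k)) (rot n p (p * k)) z = z" if "z \<in> r" for z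
    using assms that by (cases z) (auto simp: rot_period)
  then show ?thesis
    unfolding rotrel_def by simp
qed

lemma rotrel_funpow:
  assumes "r \<subseteq> {..<p + n} \<times> {..<p + n}"
  shows "(rotrel n p 1 ^^ i) r = rotrel n p i r"
  using assms rotrel_period[OF assms, of 0] by (induction i) (auto simp: rotrel_rotrel)

lemma preorder_on_rotrel:
  assumes "p > 0" and r: "preorder_on {..<p + n} r"
  shows "preorder_on {..<p + n} (rotrel n p i r)"
proof -
  let ?S = "{..<p + n}" and ?j = "p * i - i"
  have rS: "r \<subseteq> ?S \<times> ?S" and refl: "\<And>x. x \<in> ?S \<Longrightarrow> (x, x) \<in> r" and "trans r"
    using r by (auto simp: preorder_on_def refl_on_def)
  (* rot n p ?j is the inverse of rot n p i on ?S. *)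
  have ij: "?j + i = p * i" using assms(1) by simp
  have inv: "rot n p ?j (rot n p i x) = x" "rot n p i (rot n p ?j x) = x" if "x \<in> ?S" for x
    using that rot_period[of x p n i] ij by (auto simp: rot_rot add.commute)
  have mem: "(x, y) \<in> rotrel n p i r \<longleftrightarrow>
      x \<in> ?S \<and> y \<in> ?S \<and> (rot n p ?j x, rot n p ?j y) \<in> r" for x y
  proof
    assume "(x, y) \<in> rotrel n p i r"
    then show "x \<in> ?S \<and> y \<in> ?S \<and> (rot n p ?j x, rot n p ?j y) \<in> r"
      using rS inv rot_less[OF assms(1)] by (auto simp: rotrel_def)
  next
    assume *: "x \<in> ?S \<and> y \<in> ?S \<and> (rot n p ?j x, rot n p ?j y) \<in> r"
    then have "map_prod (rot n p i) (rot n p i) (rot n p ?j x, rot n p ?j y) = (x, y)"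
      using inv by auto
    then show "(x, y) \<in> rotrel n p i r"
      unfolding rotrel_def using * by (metis image_eqI)
  qed
  show ?thesis
    unfolding preorder_on_def
  proof (intro conjI)
    show "rotrel n p i r \<subseteq> ?S \<times> ?S" using mem by auto
    show "refl_on ?S (rotrel n p i r)"
      using mem refl rot_less[OF assms(1)] by (auto simp: refl_on_def)
    show "trans (rotrel n p i r)"
      using mem \<open>trans r\<close> by (meson transD transI)
  qed
qed

lemma rot_invariant:
  assumes "r \<subseteq> {..<p + n} \<times> {..<p + n}" and "rotrel n p 1 r = r" and "(x, y) \<in> r"
  shows "(rot n p i x, rot n p i y) \<in> r"
proof -
  have "(rotrel n p 1 ^^ i) r = r"
    using assms(2) by (induction i) auto
  then have "rotrel n p i r = r"
    using rotrel_funpow[OF assms(1)] by simp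
  moreover have "map_prod (rot n p i) (rot n p i) (x, y) \<in> rotrel n p i r"
    unfolding rotrel_def using assms(3) by (rule imageI)
  ultimately show ?thesis by simp
qed

text \<open>Rotating \<open>x \<le> y\<close> yields \<open>u \<le> u + d\<close> for every \<open>u\<close> in the block, where \<open>d\<close> is the
  cyclic distance from \<open>x\<close> to \<open>y\<close>. By transitivity \<open>u \<le> u + k d\<close> for all \<open>k\<close>, and the
  multiples of \<open>d\<close> exhaust the residues because \<open>d\<close> is prime to \<open>p\<close>.\<close>

lemma invariant_preorder_indiscrete:
  assumes "prime p" and r: "preorder_on {..<p + n} r" and inv: "rotrel n p 1 r = r"
    and xy: "(x, y) \<in> r" "x \<noteq> y" "n \<le> x" "n \<le> y"
  shows "{n..<p + n} \<times> {n..<p + n} \<subseteq> r"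
proof clarify
  fix u v assume uv: "u \<in> {n..<p + n}" "v \<in> {n..<p + n}"
  have p: "p > 0" using \<open>prime p\<close> prime_gt_0_nat by blast
  have rS: "r \<subseteq> {..<p + n} \<times> {..<p + n}" and refl: "\<And>x. x < p + n \<Longrightarrow> (x, x) \<in> r" and "trans r"
    using r by (auto simp: preorder_on_def refl_on_def)
  obtain i j where ij: "x = n + i" "y = n + j" "i < p" "j < p" "i \<noteq> j"
    using xy rS by (auto simp: le_iff_add)
  obtain a b where ab: "u = n + a" "v = n + b" "a < p" "b < p"
    using uv by (auto simp: le_iff_add)
  (* d represents j - i modulo p without truncated subtraction. *)
  define d where "d = j + (p - i)"
  have "\<not> p dvd d"
  proof
    assume "p dvd d"
    then have "[j + (p - i) + i = 0 + i] (mod p)"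
      unfolding d_def by (intro cong_add) (auto simp: cong_0_iff)
    then have "[j + p = i] (mod p)"
      using ij(3) by simp
    then show False
      using ij by (simp add: cong_def)
  qed
  then have "coprime d p"
    using \<open>prime p\<close> prime_imp_coprime coprime_commute by blast
  then obtain t where t: "[d * t = 1] (mod p)"
    using cong_solve_coprime_nat by auto
  have step: "(n + e mod p, n + (e + d) mod p) \<in> r" for e
  proof -
    have "(i + (e + (p - i))) mod p = e mod p"
      using ij(3) by (simp add: ac_simps)
    moreover have "j + (e + (p - i)) = e + d"
      by (simp add: d_def)
    ultimately show ?thesis
      using rot_invariant[OF rS inv xy(1), of "e + (p - i)"] ij by (simp add: rot_def)
  qed
  have chain: "(n + a mod p, n + (a + k * d) mod p) \<in> r" for k
  proof (induction k)
    case 0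
    show ?case using refl p by simp
  next
    case (Suc k)
    then show ?case
      using step[of "a + k * d"] \<open>trans r\<close> by (auto dest: transD simp: ac_simps)
  qed
  (* t inverts d, so (b - a) t steps of length d lead from a to b. *)
  have "[a + (t * (b + (p - a))) * d = a + 1 * (b + (p - a))] (mod p)"
    using cong_mult[OF t cong_refl[of "b + (p - a)"]] by (intro cong_add) (auto simp: ac_simps)
  then have "(a + (t * (b + (p - a))) * d) mod p = b"
    using ab by (simp add: cong_def)
  then show "(u, v) \<in> r"
    using chain[of "t * (b + (p - a))"] ab by simp
qed

section \<open>Collapsing the rotated block to a point\<close>

definition collapse :: "nat \<Rightarrow> nat \<Rightarrow> nat" where
  "collapse n x = (if x < n then x else n)"

text \<open>The first component is the preorder after the block has been collapsed to \<open>n\<close>; the second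
  says that the block is indiscrete. If it is not, \<open>n\<close> must be alone in its equivalence class.\<close>

definition patterns :: "nat \<Rightarrow> (nat rel \<times> bool) set" where
  "patterns n = {(s, b). preorder_on {..n} s \<and> (b \<or> (\<forall>a<n. (n, a) \<in> s \<longrightarrow> (a, n) \<notin> s))}"

definition expand :: "nat \<Rightarrow> nat \<Rightarrow> nat rel \<times> bool \<Rightarrow> nat rel" where
  "expand n p = (\<lambda>(s, b). {(x, y) \<in> {..<p + n} \<times> {..<p + n}.
     (collapse n x, collapse n y) \<in> s \<and> (b \<or> x < n \<or> y < n \<or> x = y)})"

definition pattern_of :: "nat \<Rightarrow> nat \<Rightarrow> nat rel \<Rightarrow> nat rel \<times> bool" where
  "pattern_of n p r = (r \<inter> {..n} \<times> {..n}, {n..<p + n} \<times> {n..<p + n} \<subseteq> r)"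

definition invariant_preorders :: "nat \<Rightarrow> nat \<Rightarrow> nat rel set" where
  "invariant_preorders n p = {r. preorder_on {..<p + n} r \<and> rotrel n p 1 r = r}"

text \<open>Some rotation carries \<open>x\<close> to \<open>y\<close> while fixing \<open>a\<close>.\<close>

lemma invariant_preorder_block_uniform:
  assumes "r \<in> invariant_preorders n p" "a < n" "x \<in> {n..<p + n}" "y \<in> {n..<p + n}"
  shows "(a, x) \<in> r \<Longrightarrow> (a, y) \<in> r" and "(x, a) \<in> r \<Longrightarrow> (y, a) \<in> r"
proof -
  have rS: "r \<subseteq> {..<p + n} \<times> {..<p + n}" and inv: "rotrel n p 1 r = r"
    using assms(1) by (auto simp: invariant_preorders_def preorder_on_def)
  obtain i j where ij: "x = n + i" "y = n + j" "i < p" "j < p"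
    using assms by (auto simp: le_iff_add)
  have "rot n p (j + (p - i)) x = y"
    using ij by (simp add: rot_def)
  moreover have "rot n p (j + (p - i)) a = a"
    using assms(2) by (simp add: rot_def)
  ultimately show "(a, x) \<in> r \<Longrightarrow> (a, y) \<in> r" and "(x, a) \<in> r \<Longrightarrow> (y, a) \<in> r"
    using rot_invariant[OF rS inv] by metis+
qed

lemma expand_pattern_of:
  assumes "prime p" and r: "r \<in> invariant_preorders n p"
  shows "expand n p (pattern_of n p r) = r"
proof -
  have p: "p > 0" using \<open>prime p\<close> prime_gt_0_nat by blast
  have rS: "r \<subseteq> {..<p + n} \<times> {..<p + n}" and refl: "\<And>x. x < p + n \<Longrightarrow> (x, x) \<in> r"
    and pre: "preorder_on {..<p + n} r" and inv: "rotrel n p 1 r = r"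
    using r by (auto simp: invariant_preorders_def preorder_on_def refl_on_def)
  let ?b = "{n..<p + n} \<times> {n..<p + n} \<subseteq> r"
  have "(x, y) \<in> expand n p (pattern_of n p r) \<longleftrightarrow> (x, y) \<in> r" if S: "x < p + n" "y < p + n" for x y
  proof -
    have un: "(collapse n x, collapse n y) \<in> r \<and> (?b \<or> x < n \<or> y < n \<or> x = y) \<longleftrightarrow> (x, y) \<in> r"
    proof (cases "x < n"; cases "y < n")
      assume "\<not> x < n" "\<not> y < n"
      moreover have "?b \<or> x = y" if "(x, y) \<in> r"
        using invariant_preorder_indiscrete[OF \<open>prime p\<close> pre inv that] calculation by auto
      moreover have "(x, y) \<in> r" if "?b \<or> x = y"
        using that refl S calculation by auto
      ultimately show ?thesis
        using refl[of n] p by (auto simp: collapse_def)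
    next
      assume "x < n" "\<not> y < n"
      then show ?thesis
        using invariant_preorder_block_uniform(1)[OF r, of x n y]
          invariant_preorder_block_uniform(1)[OF r, of x y n] S p by (auto simp: collapse_def)
    next
      assume "\<not> x < n" "y < n"
      then show ?thesis
        using invariant_preorder_block_uniform(2)[OF r, of y n x]
          invariant_preorder_block_uniform(2)[OF r, of y x n] S p by (auto simp: collapse_def)
    qed (auto simp: collapse_def)
    have "collapse n x \<le> n" "collapse n y \<le> n"
      by (auto simp: collapse_def)
    then show ?thesis
      using S un by (simp add: expand_def pattern_of_def)
  qed
  moreover have "expand n p (pattern_of n p r) \<subseteq> {..<p + n} \<times> {..<p + n}"
    by (auto simp: expand_def)
  ultimately show ?thesis
    using rS by blast
qed

text \<open>The bit can be recovered because \<open>p \<ge> 2\<close>: the points \<open>n\<close> and \<open>Suc n\<close> of the block are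
  related only if the bit is set.\<close>

lemma pattern_of_expand:
  assumes "prime p" and sb: "(s, b) \<in> patterns n"
  shows "pattern_of n p (expand n p (s, b)) = (s, b)"
proof -
  have p: "p > 1" using \<open>prime p\<close> prime_gt_1_nat by blast
  have s: "s \<subseteq> {..n} \<times> {..n}" "(n, n) \<in> s"
    using sb by (auto simp: patterns_def preorder_on_def refl_on_def)
  have "expand n p (s, b) \<inter> {..n} \<times> {..n} = s"
  proof -
    have "(x, y) \<in> expand n p (s, b) \<longleftrightarrow> (x, y) \<in> s" if "x \<le> n" "y \<le> n" for x y
    proof -
      have "collapse n x = x" "collapse n y = y"
        using that by (auto simp: collapse_def)
      moreover have "x < n \<or> y < n \<or> x = y"
        using that by linarith
      ultimately show ?thesis
        using that p by (simp add: expand_def)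
    qed
    then show ?thesis using s(1) by auto
  qed
  moreover have "{n..<p + n} \<times> {n..<p + n} \<subseteq> expand n p (s, b) \<longleftrightarrow> b"
  proof
    assume "{n..<p + n} \<times> {n..<p + n} \<subseteq> expand n p (s, b)"
    moreover have "(n, Suc n) \<in> {n..<p + n} \<times> {n..<p + n}" using p by auto
    ultimately have "(n, Suc n) \<in> expand n p (s, b)" by blast
    then show b by (simp add: expand_def)
  next
    assume b
    then show "{n..<p + n} \<times> {n..<p + n} \<subseteq> expand n p (s, b)"
      using s by (auto simp: expand_def collapse_def)
  qed
  ultimately show ?thesis
    by (simp add: pattern_of_def)
qed

lemma pattern_of_in_patterns:
  assumes "prime p" and r: "r \<in> invariant_preorders n p"
  shows "pattern_of n p r \<in> patterns n"
proof -
  have p: "p > 0" using \<open>prime p\<close> prime_gt_0_nat by blast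
  have refl: "\<And>x. x < p + n \<Longrightarrow> (x, x) \<in> r" and "trans r"
    using r by (auto simp: invariant_preorders_def preorder_on_def refl_on_def)
  have "preorder_on {..n} (r \<inter> {..n} \<times> {..n})"
    using refl p \<open>trans r\<close> by (auto simp: preorder_on_def refl_on_def intro!: transI dest: transD)
  moreover have "{n..<p + n} \<times> {n..<p + n} \<subseteq> r" if a: "a < n" "(n, a) \<in> r" "(a, n) \<in> r" for a
  proof clarify
    fix x y assume "x \<in> {n..<p + n}" "y \<in> {n..<p + n}"
    then have "(x, a) \<in> r" "(a, y) \<in> r"
      using invariant_preorder_block_uniform[OF r a(1), of n] a p by auto
    then show "(x, y) \<in> r"
      using \<open>trans r\<close> by (auto dest: transD)
  qed
  ultimately show ?thesis
    by (auto simp: patterns_def pattern_of_def)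
qed

text \<open>Transitivity could only fail for a chain \<open>x \<le> y \<le> z\<close> with \<open>x \<noteq> z\<close> in an antichain
  block and \<open>y\<close> outside it, which would make \<open>n\<close> equivalent to \<open>y\<close>. Invariance holds because
  rotations respect the collapsing map.\<close>

lemma expand_in_invariant_preorders:
  assumes "prime p" and sb: "(s, b) \<in> patterns n"
  shows "expand n p (s, b) \<in> invariant_preorders n p"
proof -
  let ?S = "{..<p + n}"
  have p: "p > 0" using \<open>prime p\<close> prime_gt_0_nat by blast
  have refl: "\<And>x. x \<le> n \<Longrightarrow> (x, x) \<in> s" and "trans s"
    and alone: "b \<or> (\<forall>a<n. (n, a) \<in> s \<longrightarrow> (a, n) \<notin> s)"
    using sb by (auto simp: patterns_def preorder_on_def refl_on_def)
  have "preorder_on ?S (expand n p (s, b))"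
    unfolding preorder_on_def
  proof (intro conjI transI)
    show "expand n p (s, b) \<subseteq> ?S \<times> ?S"
      by (auto simp: expand_def)
    show "refl_on ?S (expand n p (s, b))"
      using refl by (auto simp: refl_on_def expand_def collapse_def)
  next
    fix x y z assume xy: "(x, y) \<in> expand n p (s, b)" and yz: "(y, z) \<in> expand n p (s, b)"
    have "b \<or> x < n \<or> z < n \<or> x = z"
      using xy yz alone by (auto simp: expand_def collapse_def split: if_splits)
    moreover have "(collapse n x, collapse n z) \<in> s"
      using xy yz \<open>trans s\<close> by (auto simp: expand_def dest: transD)
    ultimately show "(x, z) \<in> expand n p (s, b)"
      using xy yz by (auto simp: expand_def)
  qed
  moreover have sub: "rotrel n p i (expand n p (s, b)) \<subseteq> expand n p (s, b)" for i
  proof -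
    have "collapse n (rot n p i x) = collapse n x" for x
      by (simp add: collapse_def rot_less_iff) (simp add: rot_def)
    then show ?thesis
      using rot_less[OF p] by (auto simp: rotrel_def expand_def rot_less_iff)
  qed
  moreover have "expand n p (s, b) \<subseteq> rotrel n p 1 (expand n p (s, b))"
  proof -
    have "expand n p (s, b) = rotrel n p 1 (rotrel n p (p - 1) (expand n p (s, b)))"
      unfolding rotrel_rotrel
    proof -
      have "1 + (p - 1) = p * 1" using p by simp
      moreover have "expand n p (s, b) \<subseteq> ?S \<times> ?S"
        by (auto simp: expand_def)
      ultimately show "expand n p (s, b) = rotrel n p (1 + (p - 1)) (expand n p (s, b))"
        using rotrel_period[of "expand n p (s, b)" p n 1] by simp
    qed
    also have "\<dots> \<subseteq> rotrel n p 1 (expand n p (s, b))"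
      using sub[of "p - 1"] unfolding rotrel_def by (rule image_mono)
    finally show ?thesis .
  qed
  ultimately show ?thesis
    by (auto simp: invariant_preorders_def)
qed

lemma card_invariant_preorders:
  assumes "prime p"
  shows "card (invariant_preorders n p) = card (patterns n)"
proof (rule bij_betw_same_card, rule bij_betw_byWitness)
  show "\<forall>r\<in>invariant_preorders n p. expand n p (pattern_of n p r) = r"
    using assms expand_pattern_of by blast
  show "\<forall>c\<in>patterns n. pattern_of n p (expand n p c) = c"
    using assms pattern_of_expand by auto
  show "pattern_of n p ` invariant_preorders n p \<subseteq> patterns n"
    using assms pattern_of_in_patterns by blast
  show "expand n p ` patterns n \<subseteq> invariant_preorders n p"
    using assms expand_in_invariant_preorders by auto
qed

section \<open>The residue and its uniqueness\<close>

lemma num_topologies_cong: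
  assumes "prime p"
  shows "[num_topologies (p + n) = card (patterns n)] (mod p)"
proof -
  let ?X = "{r. preorder_on {..<p + n} r}"
  have p: "p > 0" using assms prime_gt_0_nat by blast
  have rS: "r \<subseteq> {..<p + n} \<times> {..<p + n}" if "r \<in> ?X" for r
    using that by (simp add: preorder_on_def)
  have "?X \<subseteq> Pow ({..<p + n} \<times> {..<p + n})"
    using rS by blast
  then have "finite ?X"
    by (rule finite_subset) simp
  then have "[card ?X = card {r \<in> ?X. rotrel n p 1 r = r}] (mod p)"
  proof (rule cong_card_fixed_points[OF assms])
    show "rotrel n p 1 ` ?X \<subseteq> ?X"
      using preorder_on_rotrel[OF p] by auto
    show "(rotrel n p 1 ^^ p) r = r" if "r \<in> ?X" for r
      using rotrel_funpow[OF rS[OF that], of p] rotrel_period[OF rS[OF that], of 1] by simp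
  qed
  moreover have "{r \<in> ?X. rotrel n p 1 r = r} = invariant_preorders n p"
    by (auto simp: invariant_preorders_def)
  moreover have "num_topologies (p + n) = card ?X"
    using num_topologies_eq_card_preorders[of "{..<p + n}"] by simp
  ultimately show ?thesis
    using card_invariant_preorders[OF assms] by simp
qed

lemma cong_all_primes_imp_eq:
  fixes k l :: int
  assumes "\<And>p :: nat. prime p \<Longrightarrow> [k = l] (mod int p)"
  shows "k = l"
proof -
  obtain p :: nat where p: "prime p" "p > nat \<bar>k - l\<bar>"
    using bigger_prime by blast
  then have "int p dvd k - l"
    using assms by (simp add: cong_iff_dvd_diff)
  then have "k - l = 0"
    using p(2) dvd_imp_le_int[of "k - l" "int p"] by linarith
  then show ?thesis by simp
qed

theorem theorem2p7:
  fixes n :: nat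
  shows "\<exists>!k :: int. \<forall>p :: nat. prime p \<longrightarrow> [int (num_topologies (p + n)) = k] (mod int p)"
proof (rule ex_ex1I)
  show "\<exists>k :: int. \<forall>p :: nat. prime p \<longrightarrow> [int (num_topologies (p + n)) = k] (mod int p)"
    using num_topologies_cong by (auto simp: cong_int_iff intro!: exI[of _ "int (card (patterns n))"])
next
  fix k l :: int
  assume "\<forall>p :: nat. prime p \<longrightarrow> [int (num_topologies (p + n)) = k] (mod int p)"
    and "\<forall>p :: nat. prime p \<longrightarrow> [int (num_topologies (p + n)) = l] (mod int p)"
  then show "k = l"
    by (intro cong_all_primes_imp_eq) (meson cong_sym cong_trans)
qed

end
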